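(* Let $B^+(m,n)$ be the signed bistar obtained from a positive edge $uv$ by attaching $m$ pendant vertices to $u$ via positive edges and $n$ pendant vertices to $v$ via negative edges. Then $B^+(m,n)$ is a parity signed graph if and only if either $m+n$ is odd and $n\in\{m+1,m+3\}$, or $m+n$ is even and $n=m+2$.
   Context: A signed graph is a pair $S=(G,\sigma)$ with $G$ a graph and $\sigma:E(G)\to\{+,-\}$. For a graph $G$ with $N$ vertices and a bijection $f:V(G)\to\{1,\dots,N\}$, define $\sigma_f(uv)=+$ if $f(u),f(v)$ have the same parity and $\sigma_f(uv)=-$ otherwise. $S$ is a parity signed graph if $\sigma=\sigma_f$ for some such bijection $f$. *)

theory Defs
  imports Main
begin

datatype sign = Pos | Neg

text \<open>A signed graph is a graph with a sign on each edge. Edges are two-element vertex sets;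
  the values of \<open>sgn_of\<close> outside \<open>edges\<close> carry no meaning.\<close>

record 'a signed_graph =
  verts :: "'a set"
  edges :: "'a set set"
  sgn_of :: "'a set \<Rightarrow> sign"

definition wf_signed_graph :: "'a signed_graph \<Rightarrow> bool" where
  "wf_signed_graph S \<longleftrightarrow> finite (verts S) \<and>
     (\<forall>e\<in>edges S. e \<subseteq> verts S \<and> card e = 2)"

definition parity_sign :: "('a \<Rightarrow> nat) \<Rightarrow> 'a set \<Rightarrow> sign" where
  "parity_sign f e = (if \<forall>u\<in>e. \<forall>v\<in>e. even (f u) \<longleftrightarrow> even (f v) then Pos else Neg)"

lemma parity_sign_edge:
  "parity_sign f {u, v} = (if even (f u) \<longleftrightarrow> even (f v) then Pos else Neg)"
  by (auto simp: parity_sign_def)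

definition parity_signed_graph :: "'a signed_graph \<Rightarrow> bool" where
  "parity_signed_graph S \<longleftrightarrow> wf_signed_graph S \<and>
     (\<exists>f. bij_betw f (verts S) {1..card (verts S)} \<and>
          (\<forall>e\<in>edges S. sgn_of S e = parity_sign f e))"

text \<open>\<open>PendU i\<close> and \<open>PendV j\<close> are the pendant vertices attached to the two centres.\<close>

datatype bistar_vertex = CentreU | CentreV | PendU nat | PendV nat

definition signed_bistar_pos :: "nat \<Rightarrow> nat \<Rightarrow> bistar_vertex signed_graph" where
  "signed_bistar_pos m n =
     \<lparr>verts = {CentreU, CentreV} \<union> PendU ` {..<m} \<union> PendV ` {..<n},
      edges = {{CentreU, CentreV}} \<union> (\<lambda>i. {CentreU, PendU i}) ` {..<m}
                \<union> (\<lambda>j. {CentreV, PendV j}) ` {..<n},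
      sgn_of = (\<lambda>e. if e \<in> (\<lambda>j. {CentreV, PendV j}) ` {..<n} then Neg else Pos)\<rparr>"

lemma wf_signed_bistar_pos: "wf_signed_graph (signed_bistar_pos m n)"
  by (auto simp: wf_signed_graph_def signed_bistar_pos_def)

lemma sgn_of_signed_bistar_pos:
  "sgn_of (signed_bistar_pos m n) {CentreU, CentreV} = Pos"
  "sgn_of (signed_bistar_pos m n) {CentreU, PendU i} = Pos"
  "j < n \<Longrightarrow> sgn_of (signed_bistar_pos m n) {CentreV, PendV j} = Neg"
  by (auto simp: signed_bistar_pos_def doubleton_eq_iff)

end

theory Submission
  imports Defs
begin

text \<open>A positive edge joins vertices whose labels have equal parity and a negative edge joins
  vertices whose labels have opposite parity. Hence in a parity labelling of the bistar the two
  centres and the pendant vertices at the first centre form one parity class, of size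
  \<open>m + 2\<close>, and the pendant vertices at the second centre form the other, of size \<open>n\<close>. Since the
  two parity classes of \<open>{1..N}\<close> have sizes differing by at most one, this is possible
  exactly when \<open>\<bar>m + 2 - n\<bar> \<le> 1\<close>.\<close>

lemma card_even_atLeastAtMost: "card {k \<in> {1..N::nat}. even k} = N div 2"
proof (induction N)
  case (Suc N)
  have "{k \<in> {1..Suc N}. even k} =
      (if even (Suc N) then insert (Suc N) {k \<in> {1..N}. even k} else {k \<in> {1..N}. even k})"
    by (auto simp: le_Suc_eq)
  then show ?case using Suc by auto
qed simp

lemma card_odd_atLeastAtMost: "card {k \<in> {1..N::nat}. odd k} = Suc N div 2"
proof -
  have "{k \<in> {1..N}. odd k} = {1..N} - {k \<in> {1..N}. even k}"
    by auto
  also have "card \<dots> = card {1..N} - card {k \<in> {1..N}. even k}"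
    by (rule card_Diff_subset) auto
  also have "\<dots> = N - N div 2"
    unfolding card_even_atLeastAtMost by simp
  also have "\<dots> = Suc N div 2"
    by presburger
  finally show ?thesis .
qed

lemma parity_bij_exists_iff:
  assumes "finite A" "finite B" "A \<inter> B = {}"
  shows "(\<exists>f p. bij_betw f (A \<union> B) {1..card (A \<union> B)} \<and>
            (\<forall>a\<in>A. even (f a) \<longleftrightarrow> p) \<and> (\<forall>b\<in>B. even (f b) \<longleftrightarrow> \<not> p)) \<longleftrightarrow>
         card A \<le> card B + 1 \<and> card B \<le> card A + 1"
    (is "?L \<longleftrightarrow> ?R")
proof -
  define N where "N = card (A \<union> B)"
  have N: "N = card A + card B"
    unfolding N_def using assms by (rule card_Un_disjoint)
  define K where "K p = {k \<in> {1..N}. even k \<longleftrightarrow> p}" for p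
  have card_K: "card (K True) = N div 2" "card (K False) = Suc N div 2"
    using card_even_atLeastAtMost card_odd_atLeastAtMost by (simp_all add: K_def)
  have fin_K: "finite (K p)" for p
    by (simp add: K_def)
  have Un_K: "K p \<union> K (\<not> p) = {1..N}" and Int_K: "K p \<inter> K (\<not> p) = {}" for p
    by (auto simp: K_def)
  have half: "a = (a + b) div 2 \<and> b = Suc (a + b) div 2 \<longleftrightarrow> b = a \<or> b = a + 1" for a b :: nat
    by linarith
  have "?R \<longleftrightarrow> (card B = card A \<or> card B = card A + 1) \<or> (card A = card B \<or> card A = card B + 1)"
    by linarith
  then have card_iff: "?R \<longleftrightarrow> (\<exists>p. card A = card (K p) \<and> card B = card (K (\<not> p)))"
    unfolding half[symmetric] ex_bool_eq not_True_eq_False not_False_eq_True card_K N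
      add.commute[of "card B" "card A"] by blast
  show ?thesis
  proof
    assume ?L
    then obtain f p where f: "bij_betw f (A \<union> B) {1..N}"
      and p: "\<forall>a\<in>A. even (f a) \<longleftrightarrow> p" "\<forall>b\<in>B. even (f b) \<longleftrightarrow> \<not> p"
      unfolding N_def by blast
    have im: "f ` (A \<union> B) = {1..N}"
      using f by (rule bij_betw_imp_surj_on)
    have "f ` A = K p" "f ` B = K (\<not> p)"
      using p unfolding K_def im[symmetric] by auto
    moreover have "inj_on f A" "inj_on f B"
      using f by (auto simp: bij_betw_def inj_on_Un)
    ultimately show ?R
      unfolding card_iff by (metis card_image)
  next
    assume ?R
    then obtain p where "card A = card (K p)" "card B = card (K (\<not> p))"
      unfolding card_iff by blast
    then obtain g h where g: "bij_betw g A (K p)" and h: "bij_betw h B (K (\<not> p))"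
      using assms fin_K by (metis finite_same_card_bij)
    define f where "f x = (if x \<in> A then g x else h x)" for x
    have "bij_betw f A (K p)"
      using g by (rule bij_betw_cong[THEN iffD1, rotated]) (simp add: f_def)
    moreover have "bij_betw f B (K (\<not> p))"
      using h by (rule bij_betw_cong[THEN iffD1, rotated]) (use assms(3) in \<open>auto simp: f_def\<close>)
    ultimately have "bij_betw f (A \<union> B) {1..N}" "f ` A = K p" "f ` B = K (\<not> p)"
      using bij_betw_combine[OF _ _ Int_K] Un_K by (metis bij_betw_imp_surj_on)+
    then show ?L
      unfolding N_def[symmetric] by (intro exI[of _ f] exI[of _ p]) (auto simp: K_def)
  qed
qed

theorem theorem9:
  fixes m n :: nat
  shows "parity_signed_graph (signed_bistar_pos m n) \<longleftrightarrow>
    (odd (m + n) \<and> n \<in> {m + 1, m + 3}) \<or> (even (m + n) \<and> n = m + 2)"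
proof -
  define A where "A = {CentreU, CentreV} \<union> PendU ` {..<m}"
  define B where "B = PendV ` {..<n}"
  have verts: "verts (signed_bistar_pos m n) = A \<union> B"
    by (simp add: signed_bistar_pos_def A_def B_def)
  have "card (PendU ` {..<m}) = m" and card_B: "card B = n"
    by (simp_all add: B_def card_image inj_on_def)
  then have card_A: "card A = m + 2"
    by (simp add: A_def card_insert_if image_iff)
  have signs: "(\<forall>e\<in>edges (signed_bistar_pos m n). sgn_of (signed_bistar_pos m n) e = parity_sign f e)
      \<longleftrightarrow> (\<exists>p. (\<forall>a\<in>A. even (f a) \<longleftrightarrow> p) \<and> (\<forall>b\<in>B. even (f b) \<longleftrightarrow> \<not> p))"
    (is "?E \<longleftrightarrow> ?P") for f
  proof -
    have "edges (signed_bistar_pos m n) = {{CentreU, CentreV}} \<union> (\<lambda>i. {CentreU, PendU i}) ` {..<m}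
                \<union> (\<lambda>j. {CentreV, PendV j}) ` {..<n}"
      by (simp add: signed_bistar_pos_def)
    then have "?E \<longleftrightarrow> (even (f CentreU) \<longleftrightarrow> even (f CentreV)) \<and>
        (\<forall>i<m. even (f CentreU) \<longleftrightarrow> even (f (PendU i))) \<and>
        (\<forall>j<n. even (f CentreV) \<longleftrightarrow> odd (f (PendV j)))"
      by (auto simp: sgn_of_signed_bistar_pos parity_sign_edge ball_Un split: if_splits)
    also have "\<dots> \<longleftrightarrow> ?P"
      unfolding A_def B_def ex_bool_eq by auto
    finally show ?thesis .
  qed
  have "parity_signed_graph (signed_bistar_pos m n) \<longleftrightarrow> card A \<le> card B + 1 \<and> card B \<le> card A + 1"
  proof -
    have "finite A" "finite B" "A \<inter> B = {}"
      by (auto simp: A_def B_def)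
    note parity_bij_exists_iff[OF this, symmetric]
    then show ?thesis
      unfolding parity_signed_graph_def verts signs by (simp add: wf_signed_bistar_pos)
  qed
  then show ?thesis
    unfolding card_A card_B by simp presburger
qed

end
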